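(* Let $S$ be the atomic singular inner function defined by $S(z)=\exp\left(-\frac{1+z}{1-z}\right)$, $z\in\mathbb{D}$, and let $f$ be a Bloch function with $\lim_{z\to 1}|f(z)|=\infty$ (limit as $z\to 1$, $z\in\mathbb{D}$). Then the function $F$ defined by $F(z)=S(z)f(z)$, $z\in\mathbb{D}$, is not a normal function (hence, it is not a Bloch function).
   Context: $\mathbb{D}=\{z\in\mathbb{C}:|z|<1\}$ is the open unit disc. A function $f$ analytic in $\mathbb{D}$ is a Bloch function if $|f(0)|+\sup_{z\in\mathbb{D}}(1-|z|^2)|f'(z)|<\infty$. A function $f$ meromorphic in $\mathbb{D}$ is a normal function (in the sense of Lehto and Virtanen) if $\sup_{z\in\mathbb{D}}(1-|z|^2)\frac{|f'(z)|}{1+|f(z)|^2}<\infty$; here this is applied to the analytic function $F$. *)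

theory Defs
  imports "HOL-Complex_Analysis.Complex_Analysis"
begin

text \<open>Functions on the open unit disc \<open>ball 0 1\<close> are represented by total functions
  on the complex plane; all notions below depend only on the values in the disc. The suprema are
  taken in the extended reals, so that finiteness has its literal meaning.\<close>

definition bloch_function :: "(complex \<Rightarrow> complex) \<Rightarrow> bool" where
  "bloch_function f \<longleftrightarrow>
     f holomorphic_on ball 0 1 \<and>
     ereal (cmod (f 0)) + (SUP z\<in>ball 0 1. ereal ((1 - (cmod z)\<^sup>2) * cmod (deriv f z))) < \<infinity>"

text \<open>At a pole, the quotient \<open>|f'| / (1 + |f|\<^sup>2)\<close> is understood by continuity: it is invariant
  under replacing \<open>f\<close> by \<open>1 / f\<close>, and \<open>1 / f\<close> vanishes at the pole. By the library's convention
  for \<open>nicely_meromorphic_on\<close>, \<open>f\<close> takes the value 0 at its poles and \<open>inverse 0 = 0\<close>, so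
  \<open>\<lambda>w. inverse (f w)\<close> is indeed holomorphic near each pole.\<close>

definition spherical_deriv :: "(complex \<Rightarrow> complex) \<Rightarrow> complex \<Rightarrow> real" where
  "spherical_deriv f z =
     (if is_pole f z then cmod (deriv (\<lambda>w. inverse (f w)) z)
      else cmod (deriv f z) / (1 + (cmod (f z))\<^sup>2))"

definition normal_function :: "(complex \<Rightarrow> complex) \<Rightarrow> bool" where
  "normal_function f \<longleftrightarrow>
     f nicely_meromorphic_on ball 0 1 \<and>
     (SUP z\<in>ball 0 1. ereal ((1 - (cmod z)\<^sup>2) * spherical_deriv f z)) < \<infinity>"

definition atomic_inner :: "complex \<Rightarrow> complex" where
  "atomic_inner z = exp (- ((1 + z) / (1 - z)))"

end

theory Submission
  imports Defs "HOL-Real_Asymp.Real_Asymp"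
begin

text \<open>In the right half-plane coordinate \<open>w = (1 + z) / (1 - z)\<close> one has \<open>\<bar>S\<bar> = exp (- Re w)\<close>. On
  the line \<open>Re w = u\<close>, the modulus \<open>\<bar>F\<bar> = exp (-u) \<bar>f\<bar>\<close> tends to infinity at the ends, whereas at
  the real point \<open>w = u\<close> it is less than 1 once \<open>u\<close> is large, because a Bloch function grows at
  most linearly in \<open>u\<close> there. So \<open>\<bar>F\<bar> = 1\<close> somewhere on the line. At such a point
  \<open>(1 - \<bar>z\<bar>\<^sup>2) \<bar>S'/S\<bar> = 2u\<close> while \<open>(1 - \<bar>z\<bar>\<^sup>2) \<bar>S f'\<bar>\<close> stays bounded, so \<open>(1 - \<bar>z\<bar>\<^sup>2) \<bar>F'\<bar>\<close> is of
  size \<open>2u\<close>, which is unbounded.\<close>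

lemma SUP_ereal_less_PInf_imp_bounded:
  assumes "(SUP z\<in>A. ereal (g z)) < \<infinity>"
  obtains M where "\<And>z. z \<in> A \<Longrightarrow> g z \<le> M"
proof -
  obtain M :: real where "(SUP z\<in>A. ereal (g z)) < ereal M"
    using assms less_PInf_Ex_of_nat by (metis ereal_dense2)
  then have "g z \<le> M" if "z \<in> A" for z
    using SUP_upper[OF that, of "\<lambda>z. ereal (g z)"] by (meson ereal_less_eq(3) less_imp_le order_trans)
  then show thesis by (rule that)
qed

lemma bloch_function_deriv_bound:
  assumes "bloch_function f"
  obtains M where "M \<ge> 0" "\<And>z. z \<in> ball 0 1 \<Longrightarrow> (1 - (cmod z)\<^sup>2) * cmod (deriv f z) \<le> M"
proof -
  have "(SUP z\<in>ball 0 1. ereal ((1 - (cmod z)\<^sup>2) * cmod (deriv f z))) < \<infinity>"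
    using assms unfolding bloch_function_def by auto
  then obtain M where M: "\<And>z. z \<in> ball 0 1 \<Longrightarrow> (1 - (cmod z)\<^sup>2) * cmod (deriv f z) \<le> M"
    by (rule SUP_ereal_less_PInf_imp_bounded) blast
  show thesis
  proof (rule that[of "max M 0"])
    show "(1 - (cmod z)\<^sup>2) * cmod (deriv f z) \<le> max M 0" if "z \<in> ball 0 1" for z
      using M[OF that] by linarith
  qed simp
qed

text \<open>On the disc of radius \<open>x\<close> the weight satisfies
  \<open>1 - (cmod z)\<^sup>2 \<ge> 1 - x\<^sup>2 \<ge> 1 - x\<close>, so \<open>deriv f\<close> is
  bounded by \<open>M / (1 - x)\<close> there, and the mean value inequality applies. True growth is
  only logarithmic in \<open>1 / (1 - x)\<close>, but this cruder bound is enough against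
  \<open>exp u\<close>.\<close>

lemma bloch_growth:
  fixes x :: real
  assumes hol: "f holomorphic_on ball 0 1"
    and M: "\<And>z. z \<in> ball 0 1 \<Longrightarrow> (1 - (cmod z)\<^sup>2) * cmod (deriv f z) \<le> M"
    and "M \<ge> 0" and x: "0 \<le> x" "x < 1"
  shows "cmod (f (of_real x)) \<le> cmod (f 0) + M / (1 - x)"
proof -
  have "cmod (f (of_real x) - f 0) \<le> M / (1 - x) * cmod (of_real x - 0)"
  proof (rule field_differentiable_bound[of "cball 0 x" f "deriv f"])
    fix z :: complex assume "z \<in> cball 0 x"
    then have z: "cmod z \<le> x" by simp
    then have z1: "z \<in> ball 0 1" using x by simp
    show "(f has_field_derivative deriv f z) (at z within cball 0 x)"
      using holomorphic_derivI[OF hol open_ball z1] has_field_derivative_at_within by blast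
    have "(cmod z)\<^sup>2 \<le> x\<^sup>2" using z by (intro power_mono) auto
    also have "x\<^sup>2 \<le> x" using x by (simp add: power2_eq_square mult_left_le)
    finally have "(1 - x) * cmod (deriv f z) \<le> (1 - (cmod z)\<^sup>2) * cmod (deriv f z)"
      by (intro mult_right_mono) auto
    also have "\<dots> \<le> M" by (rule M[OF z1])
    finally show "cmod (deriv f z) \<le> M / (1 - x)"
      using x by (simp add: field_simps)
  qed (use x in auto)
  also have "\<dots> \<le> M / (1 - x) * 1"
    using x \<open>M \<ge> 0\<close> by (intro mult_left_mono) auto
  finally show ?thesis
    using norm_triangle_ineq2[of "f (of_real x)" "f 0"] by simp
qed

text \<open>The right-hand side is the Poisson kernel with pole at 1. Its level sets in the disc are
  the horocycles at 1, the images of the vertical lines.\<close>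

lemma Re_cayley: "Re ((1 + z) / (1 - z)) = (1 - (cmod z)\<^sup>2) / (cmod (1 - z))\<^sup>2"
  unfolding Re_divide cmod_power2 by (simp add: power2_eq_square algebra_simps)

text \<open>A point of the right half-plane is nearer to 1 than to -1, which puts \<open>z\<close>
  in the disc.\<close>

lemma cayley_inverse:
  assumes "Re w > 0"
  defines "z \<equiv> (w - 1) / (w + 1)"
  shows "z \<in> ball 0 1" "(1 + z) / (1 - z) = w"
proof -
  have w: "w + 1 \<noteq> 0"
    using assms by (auto simp: complex_eq_iff)
  have "(cmod (w - 1))\<^sup>2 < (cmod (w + 1))\<^sup>2"
    using assms(1) unfolding cmod_power2 by (simp add: power2_eq_square algebra_simps)
  then have "cmod (w - 1) < cmod (w + 1)"
    by (rule power_less_imp_less_base) simp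
  then show "z \<in> ball 0 1"
    using w by (simp add: z_def norm_divide)
  have "1 + z = 2 * w / (w + 1)" "1 - z = 2 / (w + 1)"
    using w by (simp_all add: z_def field_simps)
  then show "(1 + z) / (1 - z) = w"
    using w by simp
qed

lemma norm_atomic_inner: "cmod (atomic_inner z) = exp (- Re ((1 + z) / (1 - z)))"
  by (simp add: atomic_inner_def)

lemma has_field_derivative_atomic_inner:
  assumes "z \<noteq> 1"
  shows "(atomic_inner has_field_derivative - 2 / (1 - z)\<^sup>2 * atomic_inner z) (at z)"
  unfolding atomic_inner_def using assms
  by (auto intro!: derivative_eq_intros simp: field_simps power2_eq_square)

text \<open>The intermediate value theorem is applied to \<open>cmod (f (p t))\<close> along one
  half of the horocycle, from its real point \<open>p 0\<close>, where \<open>small\<close> holds,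
  towards 1, where \<open>lim\<close> forces large values.\<close>

lemma unimodular_point_on_horocycle:
  assumes hol: "f holomorphic_on ball 0 1"
    and lim: "filterlim (\<lambda>z. cmod (f z)) at_top (at 1 within ball 0 1)"
    and "u > 0" and small: "cmod (f (of_real ((u - 1) / (u + 1)))) < exp u"
  obtains z where "z \<in> ball 0 1" "Re ((1 + z) / (1 - z)) = u" "cmod (f z) = exp u"
proof -
  define p where "p t = (Complex u t - 1) / (Complex u t + 1)" for t
  have p: "p t \<in> ball 0 1" "(1 + p t) / (1 - p t) = Complex u t" for t
    using cayley_inverse[of "Complex u t"] \<open>u > 0\<close> by (auto simp: p_def)
  have nz: "Complex u t + 1 \<noteq> 0" for t
    using \<open>u > 0\<close> by (auto simp: complex_eq_iff)
  have contp: "continuous_on A p" for A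
    unfolding p_def Complex_eq using nz by (auto intro!: continuous_intros simp: Complex_eq)
  have "filterlim (\<lambda>t. Complex u t + 1) at_infinity at_top"
  proof (rule filterlim_norm_at_top_imp_at_infinity, rule filterlim_at_top_mono)
    show "\<forall>\<^sub>F t in at_top. t \<le> norm (Complex u t + 1)"
    proof (rule always_eventually, rule allI)
      show "t \<le> norm (Complex u t + 1)" for t
        using abs_Im_le_cmod[of "Complex u t + 1"] by simp
    qed
  qed (rule filterlim_ident)
  then have "((\<lambda>t. 1 - 2 / (Complex u t + 1)) \<longlongrightarrow> 1 - 0) at_top"
    by (intro tendsto_intros tendsto_divide_0[OF tendsto_const])
  moreover have "p = (\<lambda>t. 1 - 2 / (Complex u t + 1))"
    using nz by (auto simp: p_def field_simps)
  ultimately have "(p \<longlongrightarrow> 1) at_top" by simp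
  \<comment> \<open>The punctured filter also demands \<open>p t \<noteq> 1\<close>, which holds
    because \<open>p t\<close> has modulus less than 1.\<close>
  then have "filterlim p (at 1 within ball 0 1) at_top"
    unfolding filterlim_at
    using p(1) by (auto intro!: always_eventually)
      (metis diff_zero dist_norm less_irrefl mem_ball norm_minus_commute norm_one)
  then have "filterlim (\<lambda>t. cmod (f (p t))) at_top at_top"
    by (rule filterlim_compose[OF lim])
  then have "\<forall>\<^sub>F t in at_top. 0 \<le> t \<and> exp u \<le> cmod (f (p t))"
    by (intro eventually_conj eventually_ge_at_top) (simp add: filterlim_at_top)
  then obtain t1 where t1: "0 \<le> t1" "exp u \<le> cmod (f (p t1))"
    using eventually_happens by fastforce
  have p0: "p 0 = of_real ((u - 1) / (u + 1))"
    by (simp add: p_def Complex_eq)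
  have "continuous_on {0..t1} (\<lambda>t. cmod (f (p t)))"
    using p(1)
    by (intro continuous_on_norm
          continuous_on_compose2[OF holomorphic_on_imp_continuous_on[OF hol] contp]) auto
  then obtain t where "cmod (f (p t)) = exp u"
    using IVT'[of "\<lambda>t. cmod (f (p t))" 0 "exp u" t1] small t1 p0 by auto
  then show thesis
    using that[of "p t"] p[of t] by simp
qed

text \<open>By the product rule \<open>deriv\<close> splits into
  \<open>-2 / (1 - z)\<^sup>2 * (S * f)\<close> and \<open>S * f'\<close>, with \<open>S\<close> the
  atomic inner function. Since \<open>S * f\<close> has modulus \<open>exp (-u) * exp u = 1\<close>,
  the first term times the weight has modulus exactly \<open>2 * u\<close> by
  \<open>Re_cayley\<close>. Since \<open>cmod S \<le> 1\<close>, the second contributes at most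
  \<open>M\<close>.\<close>

lemma norm_deriv_atomic_inner_mult_ge:
  assumes hol: "f holomorphic_on ball 0 1" and z: "z \<in> ball 0 1"
    and M: "(1 - (cmod z)\<^sup>2) * cmod (deriv f z) \<le> M" "M \<ge> 0"
    and u: "Re ((1 + z) / (1 - z)) = u" "u \<ge> 0" and fz: "cmod (f z) = exp u"
  shows "(1 - (cmod z)\<^sup>2) * cmod (deriv (\<lambda>z. atomic_inner z * f z) z) \<ge> 2 * u - M"
proof -
  let ?S = "atomic_inner z" and ?d = "1 - (cmod z)\<^sup>2"
  have z1: "z \<noteq> 1" using z by auto
  have d: "?d \<ge> 0" using z by (simp add: power_le_one)
  have S: "cmod ?S = exp (- u)" by (simp add: norm_atomic_inner u)
  have "deriv (\<lambda>z. atomic_inner z * f z) z = ?S * deriv f z - 2 / (1 - z)\<^sup>2 * (?S * f z)"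
    by (rule DERIV_imp_deriv)
       (auto intro!: derivative_eq_intros has_field_derivative_atomic_inner[OF z1]
          holomorphic_derivI[OF hol open_ball z] simp: algebra_simps)
  then have "cmod (2 / (1 - z)\<^sup>2 * (?S * f z)) - cmod (?S * deriv f z)
      \<le> cmod (deriv (\<lambda>z. atomic_inner z * f z) z)"
    by (metis norm_minus_commute norm_triangle_ineq2)
  moreover have "cmod (2 / (1 - z)\<^sup>2 * (?S * f z)) = 2 / (cmod (1 - z))\<^sup>2"
    by (simp add: norm_mult norm_divide norm_power S fz flip: exp_add)
  moreover have "cmod (?S * deriv f z) \<le> cmod (deriv f z)"
    using u(2) by (simp add: norm_mult S mult_left_le_one_le)
  ultimately have "2 / (cmod (1 - z))\<^sup>2 - cmod (deriv f z)
      \<le> cmod (deriv (\<lambda>z. atomic_inner z * f z) z)"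
    by linarith
  from mult_left_mono[OF this d]
  have "?d * (2 / (cmod (1 - z))\<^sup>2) - ?d * cmod (deriv f z)
      \<le> ?d * cmod (deriv (\<lambda>z. atomic_inner z * f z) z)"
    by (simp only: right_diff_distrib)
  moreover have "?d * (2 / (cmod (1 - z))\<^sup>2) = 2 * u"
    using u(1) unfolding Re_cayley by auto
  ultimately show ?thesis
    using M(1) by linarith
qed

text \<open>This serves both claims: unboundedness alone refutes the Bloch property, and modulus 1
  keeps the spherical derivative comparable to the ordinary one.\<close>

lemma atomic_inner_mult_bloch_unbounded:
  assumes bloch: "bloch_function f"
    and lim: "filterlim (\<lambda>z. cmod (f z)) at_top (at 1 within ball 0 1)"
  obtains z where "z \<in> ball 0 1" "cmod (atomic_inner z * f z) = 1"
    "(1 - (cmod z)\<^sup>2) * cmod (deriv (\<lambda>z. atomic_inner z * f z) z) > B"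
proof -
  have hol: "f holomorphic_on ball 0 1"
    using bloch by (simp add: bloch_function_def)
  obtain M where M: "M \<ge> 0" "\<And>z. z \<in> ball 0 1 \<Longrightarrow> (1 - (cmod z)\<^sup>2) * cmod (deriv f z) \<le> M"
    using bloch by (rule bloch_function_deriv_bound) blast
  \<comment> \<open>At \<open>x = (u - 1) / (u + 1)\<close> one has
    \<open>1 - x = 2 / (u + 1)\<close>, so the left side is the bound of
    \<open>bloch_growth\<close>. Below, \<open>1 \<le> u\<close> ensures \<open>x \<ge> 0\<close>,
    and \<open>(B + M) / 2 < u\<close> means \<open>2 * u - M > B\<close>.\<close>
  have "\<forall>\<^sub>F u :: real in at_top. cmod (f 0) + M * ((u + 1) / 2) < exp u"
    by real_asymp
  then have "\<forall>\<^sub>F u :: real in at_top.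
      cmod (f 0) + M * ((u + 1) / 2) < exp u \<and> 1 \<le> u \<and> (B + M) / 2 < u"
    by (intro eventually_conj eventually_ge_at_top eventually_gt_at_top)
  then obtain u :: real where
    u: "cmod (f 0) + M * ((u + 1) / 2) < exp u" "1 \<le> u" "(B + M) / 2 < u"
    using eventually_happens by fastforce
  have "cmod (f (of_real ((u - 1) / (u + 1)))) \<le> cmod (f 0) + M / (1 - (u - 1) / (u + 1))"
    using u(2) by (intro bloch_growth[OF hol M(2) M(1)]) auto
  also have "M / (1 - (u - 1) / (u + 1)) = M * ((u + 1) / 2)"
    using u(2) by (simp add: field_simps)
  also note u(1)
  finally obtain z where z: "z \<in> ball 0 1" "Re ((1 + z) / (1 - z)) = u" "cmod (f z) = exp u"
    using u(2) by (auto intro: unimodular_point_on_horocycle[OF hol lim, of u])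
  show thesis
  proof (rule that[OF z(1)])
    show "cmod (atomic_inner z * f z) = 1"
      by (simp add: norm_mult norm_atomic_inner z flip: exp_add)
    show "(1 - (cmod z)\<^sup>2) * cmod (deriv (\<lambda>z. atomic_inner z * f z) z) > B"
      using norm_deriv_atomic_inner_mult_ge[OF hol z(1) M(2)[OF z(1)] M(1) z(2) _ z(3)] u by auto
  qed
qed

theorem theorem1p1:
  fixes f :: "complex \<Rightarrow> complex"
  assumes "bloch_function f"
    and "filterlim (\<lambda>z. cmod (f z)) at_top (at 1 within ball 0 1)"
  shows "\<not> normal_function (\<lambda>z. atomic_inner z * f z) \<and>
         \<not> bloch_function (\<lambda>z. atomic_inner z * f z)"
proof -
  let ?F = "\<lambda>z. atomic_inner z * f z"
  have hol: "?F holomorphic_on ball 0 1"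
    using assms(1) unfolding bloch_function_def atomic_inner_def
    by (auto intro!: holomorphic_intros)
  have "\<not> normal_function ?F"
  proof
    assume "normal_function ?F"
    then have "(SUP z\<in>ball 0 1. ereal ((1 - (cmod z)\<^sup>2) * spherical_deriv ?F z)) < \<infinity>"
      by (simp add: normal_function_def)
    then obtain B where B: "\<And>z. z \<in> ball 0 1 \<Longrightarrow> (1 - (cmod z)\<^sup>2) * spherical_deriv ?F z \<le> B"
      by (rule SUP_ereal_less_PInf_imp_bounded) blast
    \<comment> \<open>The factor 2 is the denominator \<open>1 + (cmod (?F z))\<^sup>2\<close> at a
      point where \<open>?F\<close> has modulus 1.\<close>
    obtain z where z: "z \<in> ball 0 1" "cmod (?F z) = 1"
      "(1 - (cmod z)\<^sup>2) * cmod (deriv ?F z) > 2 * B"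
      using assms by (rule atomic_inner_mult_bloch_unbounded)
    have "\<not> is_pole ?F z"
      using hol z(1) by (meson not_is_pole_holomorphic open_ball)
    then have "cmod (deriv ?F z) = 2 * spherical_deriv ?F z"
      using z(2) by (simp add: spherical_deriv_def)
    then show False
      using B[OF z(1)] z(3) by simp
  qed
  moreover have "\<not> bloch_function ?F"
  proof
    assume "bloch_function ?F"
    then obtain B where "\<And>z. z \<in> ball 0 1 \<Longrightarrow> (1 - (cmod z)\<^sup>2) * cmod (deriv ?F z) \<le> B"
      by (rule bloch_function_deriv_bound) blast
    then show False
      using atomic_inner_mult_bloch_unbounded[OF assms, of B] by (metis not_le)
  qed
  ultimately show ?thesis ..
qed

end
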